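(* Let $d\ge 2$ and $n\ge 1$ be integers and let $\mathcal{H}$ be a $d$-uniform hypergraph on the vertex set $\{x_{ji}\mid 1\le j\le n,\ 1\le i\le d\}$ (with $nd$ distinct vertices) such that $$\{\{x_{j1},x_{j2},\ldots,x_{jd}\}\mid 1\le j\le n\}$$ is a perfect matching of $\mathcal{H}$. If $\mathcal{H}$ is unmixed and has a minimal vertex cover of size $n$, then for every $1\le q\le n$ the following holds: if $\mathfrak{e}_1,\mathfrak{e}_2$ are (possibly equal) submaximal edges such that $\mathfrak{e}_1\sim x_{qi_1}$ and $\mathfrak{e}_2\sim x_{qi_2}$, where $i_1,i_2\in\{1,\ldots,d\}$ are distinct, then the set $\mathfrak{e}_1\cup\mathfrak{e}_2$ is not independent.
   Context: A hypergraph $\mathcal{H}$ on a finite nonempty set $V=V(\mathcal{H})$ (the vertices) is a set $E(\mathcal{H})$ of nonempty subsets of $V$ (the hyperedges) whose union is $V$. It is $d$-uniform if every hyperedge has exactly $d$ elements. A matching is a set of pairwise disjoint hyperedges; it is perfect if every vertex lies in one of its elements. A subset of $V(\mathcal{H})$ is independent if it does not contain any hyperedge as a subset. A vertex cover is a subset of $V(\mathcal{H})$ that intersects every hyperedge; it is minimal if no proper subset of it is a vertex cover. $\mathcal{H}$ is unmixed if all its minimal vertex covers have the same cardinality. In a $d$-uniform hypergraph, a submaximal edge is a $(d-1)$-element subset of a hyperedge. For a submaximal edge $\mathfrak{e}$ and a vertex $v$, write $\mathfrak{e}\sim v$ if $\mathfrak{e}\cup\{v\}\in E(\mathcal{H})$.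 *)

theory Defs
  imports Main "HOL-Library.Disjoint_Sets"
begin

definition hypergraph :: "'a set \<Rightarrow> 'a set set \<Rightarrow> bool" where
  "hypergraph V E \<longleftrightarrow> finite V \<and> V \<noteq> {} \<and> (\<forall>e\<in>E. e \<noteq> {} \<and> e \<subseteq> V) \<and> \<Union>E = V"

definition uniform :: "nat \<Rightarrow> 'a set set \<Rightarrow> bool" where
  "uniform d E \<longleftrightarrow> (\<forall>e\<in>E. card e = d)"

definition matching :: "'a set set \<Rightarrow> 'a set set \<Rightarrow> bool" where
  "matching E M \<longleftrightarrow> M \<subseteq> E \<and> disjoint M"

definition perfect_matching :: "'a set \<Rightarrow> 'a set set \<Rightarrow> 'a set set \<Rightarrow> bool" where
  "perfect_matching V E M \<longleftrightarrow> matching E M \<and> (\<forall>v\<in>V. \<exists>e\<in>M. v \<in> e)"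

definition independent :: "'a set \<Rightarrow> 'a set set \<Rightarrow> 'a set \<Rightarrow> bool" where
  "independent V E S \<longleftrightarrow> S \<subseteq> V \<and> \<not> (\<exists>e\<in>E. e \<subseteq> S)"

definition vertex_cover :: "'a set \<Rightarrow> 'a set set \<Rightarrow> 'a set \<Rightarrow> bool" where
  "vertex_cover V E C \<longleftrightarrow> C \<subseteq> V \<and> (\<forall>e\<in>E. C \<inter> e \<noteq> {})"

definition minimal_vertex_cover :: "'a set \<Rightarrow> 'a set set \<Rightarrow> 'a set \<Rightarrow> bool" where
  "minimal_vertex_cover V E C \<longleftrightarrow>
     vertex_cover V E C \<and> \<not> (\<exists>C'. C' \<subset> C \<and> vertex_cover V E C')"

definition unmixed :: "'a set \<Rightarrow> 'a set set \<Rightarrow> bool" where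
  "unmixed V E \<longleftrightarrow>
     (\<forall>C D. minimal_vertex_cover V E C \<and> minimal_vertex_cover V E D \<longrightarrow> card C = card D)"

definition submaximal_edge :: "nat \<Rightarrow> 'a set set \<Rightarrow> 'a set \<Rightarrow> bool" where
  "submaximal_edge d E s \<longleftrightarrow> (\<exists>e\<in>E. s \<subseteq> e) \<and> card s = d - 1"

text \<open>The relation written \<open>s \<sim> v\<close> in the literature, used for submaximal edges \<open>s\<close>.\<close>

definition completes :: "'a set set \<Rightarrow> 'a set \<Rightarrow> 'a \<Rightarrow> bool" where
  "completes E s v \<longleftrightarrow> s \<union> {v} \<in> E"

end

theory Submission
  imports Defs
begin

text \<open>If \<open>e1 \<union> e2\<close> were independent, some minimal vertex cover would avoid it and hence contain
  both \<open>x q i1\<close> and \<open>x q i2\<close>. By unmixedness this cover has \<open>n\<close> elements, so it meets each of the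
  \<open>n\<close> disjoint edges of the perfect matching exactly once, a contradiction.\<close>

lemma vertex_cover_contains_minimal:
  assumes "finite C" "vertex_cover V E C"
  obtains D where "D \<subseteq> C" "minimal_vertex_cover V E D"
proof -
  have "finite {D. D \<subseteq> C \<and> vertex_cover V E D}" "C \<in> {D. D \<subseteq> C \<and> vertex_cover V E D}"
    using assms by auto
  from finite_has_minimal2[OF this] obtain D where
    D: "D \<subseteq> C" "vertex_cover V E D"
    and min: "\<And>D'. D' \<subseteq> C \<Longrightarrow> vertex_cover V E D' \<Longrightarrow> D' \<subseteq> D \<Longrightarrow> D = D'"
    by auto
  \<comment> \<open>\<open>D\<close> is minimal only among the covers inside \<open>C\<close>, but
    every proper subset of \<open>D\<close> lies in \<open>C\<close> anyway.\<close>
  have "minimal_vertex_cover V E D"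
    unfolding minimal_vertex_cover_def using D min by blast
  with D that show thesis by blast
qed

lemma independent_imp_vertex_cover_diff:
  assumes "hypergraph V E" "independent V E S"
  shows "vertex_cover V E (V - S)"
  using assms unfolding hypergraph_def independent_def vertex_cover_def by blast

text \<open>A counting argument: choosing one element of \<open>C\<close> from each row
  \<open>x j\<close> gives distinct elements, since different rows share none. There are as many
  rows as elements of \<open>C\<close>, so the chosen elements exhaust \<open>C\<close> and no row
  has room for a second one.\<close>

lemma transversal_unique:
  assumes inj: "inj_on (\<lambda>(j, i). x j i) (J \<times> I)"
    and "finite C" "card C = card J"
    and hit: "\<And>j. j \<in> J \<Longrightarrow> \<exists>i\<in>I. x j i \<in> C"
    and "q \<in> J" "i1 \<in> I" "i2 \<in> I" "x q i1 \<in> C" "x q i2 \<in> C"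
  shows "i1 = i2"
proof -
  obtain g where g: "\<And>j. j \<in> J \<Longrightarrow> g j \<in> I \<and> x j (g j) \<in> C"
    using hit by metis
  have x_eqD: "j = j' \<and> i = i'"
    if "x j i = x j' i'" "j \<in> J" "j' \<in> J" "i \<in> I" "i' \<in> I" for j j' i i'
    using inj_onD[OF inj, of "(j, i)" "(j', i')"] that by simp
  have "inj_on (\<lambda>j. x j (g j)) J"
    using g x_eqD by (meson inj_onI)
  then have "card ((\<lambda>j. x j (g j)) ` J) = card C"
    using assms(3) by (simp add: card_image)
  then have C: "(\<lambda>j. x j (g j)) ` J = C"
    using g \<open>finite C\<close> by (intro card_subset_eq) auto
  have "i = g q" if "i \<in> I" "x q i \<in> C" for i
  proof -
    \<comment> \<open>An element of \<open>C\<close> in row \<open>q\<close> was chosen from some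
      row \<open>j\<close>; injectivity of the labelling forces \<open>j = q\<close>.\<close>
    from that C obtain j where "j \<in> J" "x q i = x j (g j)" by auto
    then show ?thesis using x_eqD[of q i j "g j"] g[of j] that \<open>q \<in> J\<close> by simp
  qed
  from this[of i1] this[of i2] show ?thesis using assms(6-9) by argo
qed

theorem proposition3p6:
  fixes d n :: nat
    and x :: "nat \<Rightarrow> nat \<Rightarrow> 'a"
    and V :: "'a set"
    and E :: "'a set set"
  assumes "d \<ge> 2" and "n \<ge> 1"
    and "hypergraph V E" and "uniform d E"
    and "inj_on (\<lambda>(j, i). x j i) ({1..n} \<times> {1..d})"
    and "V = {x j i | j i. j \<in> {1..n} \<and> i \<in> {1..d}}"
    and "perfect_matching V E {{x j i | i. i \<in> {1..d}} | j. j \<in> {1..n}}"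
    and "unmixed V E"
    and "\<exists>C. minimal_vertex_cover V E C \<and> card C = n"
  shows "\<forall>q\<in>{1..n}. \<forall>e1 e2. \<forall>i1\<in>{1..d}. \<forall>i2\<in>{1..d}.
    submaximal_edge d E e1 \<and> submaximal_edge d E e2 \<and> i1 \<noteq> i2 \<and>
    completes E e1 (x q i1) \<and> completes E e2 (x q i2) \<longrightarrow>
    \<not> independent V E (e1 \<union> e2)"
proof (intro ballI allI impI notI)
  fix q e1 e2 i1 i2
  assume q: "q \<in> {1..n}" and i: "i1 \<in> {1..d}" "i2 \<in> {1..d}"
    and e: "submaximal_edge d E e1 \<and> submaximal_edge d E e2 \<and> i1 \<noteq> i2 \<and>
      completes E e1 (x q i1) \<and> completes E e2 (x q i2)"
    and indep: "independent V E (e1 \<union> e2)"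
  have "finite (V - (e1 \<union> e2))"
    using assms(3) by (simp add: hypergraph_def)
  \<comment> \<open>The complement of an independent set is a cover: an edge missing it would lie
    inside \<open>e1 \<union> e2\<close>.\<close>
  then obtain C where C: "C \<subseteq> V - (e1 \<union> e2)" "minimal_vertex_cover V E C"
    using vertex_cover_contains_minimal independent_imp_vertex_cover_diff[OF assms(3) indep]
    by metis
  then have finC: "finite C"
    using assms(3) by (metis finite_Diff finite_subset hypergraph_def)
  have cover: "C \<inter> f \<noteq> {}" if "f \<in> E" for f
    using C(2) that by (simp add: minimal_vertex_cover_def vertex_cover_def)
  \<comment> \<open>Unmixedness transfers the size \<open>n\<close> from the given minimal cover to
    \<open>C\<close>.\<close>
  have cardC: "card C = card {1..n}"
    using C(2) assms(8,9) unfolding unmixed_def by (metis card_atLeastAtMost diff_Suc_1)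
  have hit: "\<exists>i\<in>{1..d}. x j i \<in> C" if "j \<in> {1..n}" for j
  proof -
    have "{x j i | i. i \<in> {1..d}} \<in> E"
      using assms(7) that unfolding perfect_matching_def matching_def by blast
    from cover[OF this] show ?thesis by blast
  qed
  \<comment> \<open>\<open>C\<close> meets the edge \<open>e1 \<union> {x q i1}\<close> but avoids
    \<open>e1\<close>, so it can only meet it in \<open>x q i1\<close>; likewise for
    \<open>e2\<close>.\<close>
  have "x q i1 \<in> C" "x q i2 \<in> C"
    using cover[of "e1 \<union> {x q i1}"] cover[of "e2 \<union> {x q i2}"] e C(1)
    unfolding completes_def by blast+
  from transversal_unique[OF assms(5) finC cardC hit q i this] e
  show False by simp
qed

end
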